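(* Let $q=2$, let $k_1,k_2\ge 2$ be integers with $\gcd(k_1,k_2)=1$, and let $Q_1=2^{k_1}$, $Q_2=2^{k_2}$. Let $\alpha_1,\alpha_2$ be primitive elements of $\mathbb{F}_{Q_1}$ and $\mathbb{F}_{Q_2}$, respectively. Let $n=(Q_1-1)(Q_2-1)$, and let $C=\{c(\beta_1,\beta_2):\beta_1\in\mathbb{F}_{Q_1},\beta_2\in\mathbb{F}_{Q_2}\}\subset\mathbb{F}_2^n$ and $C'=\{c(0,\beta_2):\beta_2\in\mathbb{F}_{Q_2}\}\subset C$, where $c(\beta_1,\beta_2)=\big(T_q^{Q_1}(\beta_1\alpha_1^i)+T_q^{Q_2}(\beta_2\alpha_2^i)\big)_{0\le i\le n-1}$. Then for every $1\leq j\leq k_1$, $$M_j(C,C')=(Q_1-1)(Q_2-1)-N_j,$$ where, if $k_1\leq k_2$, then $$N_j=q^{k_1+k_2-j}-q^{k_1-j}-q^{k_2-j}+1;$$ and if $k_2<k_1$, then $$N_j=\begin{cases} q^{k_1+k_2-j}-q^{k_1-j}-q^{k_2-j}+1, & \text{if } 1\leq j\leq k_2;\\ q^{k_1+k_2-j}-q^{k_1-j}, & \text{if } k_2<j\leq k_1.\end{cases}$$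
   Context: $T_q^{Q_i}$ denotes the trace map from $\mathbb{F}_{Q_i}$ to $\mathbb{F}_q$. The code $C$ has dimension $k_1+k_2$ over $\mathbb{F}_q$ and $C'$ has dimension $k_2$. For an $\mathbb{F}_q$-linear subspace $D\subset\mathbb{F}_q^n$, $\mathrm{Supp}(D)$ is the set of coordinate positions $i$ such that $v_i\neq 0$ for some $v\in D$. For linear codes $C'\subset C\subset \mathbb{F}_q^n$ and $1\le j\le \dim C-\dim C'$, the $j$th relative generalized Hamming weight of $C$ with respect to $C'$ is $$M_j(C,C')=\min\{|\mathrm{Supp}(D)| : D\subset C \text{ an } \mathbb{F}_q\text{-linear subspace},\ \dim D=j,\ D\cap C'=\{0\}\}.$$ *)

theory Defs
  imports
    Complex_Main
    "HOL-Library.Z2"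
    "HOL-Library.Cardinality"
    "HOL-Library.Function_Algebras"
    "HOL-Computational_Algebra.Primes"
begin

text \<open>
  The space \<open>F\<^sup>n\<close> is modelled by the sequences \<^typ>\<open>nat \<Rightarrow> 'q\<close> vanishing at all positions
  \<open>i \<ge> n\<close>. All sequences together form a vector space over \<open>F\<close> under the pointwise operations,
  so subspaces and dimensions of codes are the library's notions for that space.
\<close>

definition seq_scale :: "'q::field \<Rightarrow> (nat \<Rightarrow> 'q) \<Rightarrow> nat \<Rightarrow> 'q" where
  "seq_scale c v = (\<lambda>i. c * v i)"

global_interpretation seq_space: vector_space seq_scale
  by unfold_locales (auto simp: seq_scale_def algebra_simps)

definition Supp :: "(nat \<Rightarrow> 'q::field) set \<Rightarrow> nat set" where
  "Supp D = {i. \<exists>v\<in>D. v i \<noteq> 0}"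

definition rel_gen_Hamming_weight ::
    "nat \<Rightarrow> (nat \<Rightarrow> 'q::field) set \<Rightarrow> (nat \<Rightarrow> 'q) set \<Rightarrow> nat" where
  "rel_gen_Hamming_weight j C C' =
     Min {card (Supp D) | D.
            D \<subseteq> C \<and> seq_space.subspace D \<and> seq_space.dim D = j \<and> D \<inter> C' = {0}}"

definition degree_over_F2 :: "'a::finite_field itself \<Rightarrow> nat" where
  "degree_over_F2 _ = (THE m. CARD('a) = 2 ^ m)"

text \<open>
  The trace is the sum of the conjugates \<open>x\<^bsup>2\<^sup>i\<^esup>\<close> over \<open>GF(2)\<close>. This sum is an element of the
  prime field of \<^typ>\<open>'a\<close>; \<^const>\<open>of_bit\<close> is the embedding of \<open>GF(2)\<close>, i.e. \<^typ>\<open>bit\<close>, onto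
  that prime field, and the trace is the preimage of the sum. It is meaningful only if \<^typ>\<open>'a\<close>
  has characteristic 2.
\<close>

definition trace_to_F2 :: "'a::finite_field \<Rightarrow> bit" where
  "trace_to_F2 x = (THE b. of_bit b = (\<Sum>i<degree_over_F2 TYPE('a). x ^ (2 ^ i)))"

lemma of_bit_trace_to_F2:
  fixes x :: "'a::finite_field"
  assumes card: "CARD('a) = 2 ^ k"
  shows "of_bit (trace_to_F2 x) = (\<Sum>i<k. x ^ (2 ^ i))"
proof -
  let ?s = "\<Sum>i<k. x ^ (2 ^ i)"
  have deg: "degree_over_F2 TYPE('a) = k"
    unfolding degree_over_F2_def card by (rule the_equality) auto
  have "bij (\<lambda>y::'a. y + 1)"
    by (rule bij_betw_byWitness[where f' = "\<lambda>y. y - 1"]) auto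
  then have "(\<Sum>y\<in>(UNIV::'a set). y + 1) = (\<Sum>y\<in>UNIV. y)"
    using sum.reindex_bij_betw[of "\<lambda>y::'a. y + 1" UNIV UNIV "\<lambda>y. y"] by simp
  then have "(of_nat CARD('a) :: 'a) = 0"
    by (simp add: sum.distrib)
  then have "CHAR('a) dvd 2 ^ k"
    using card of_nat_eq_0_iff_char_dvd by metis
  then have char: "CHAR('a) = 2"
    by (metis CHAR_prime prime_dvd_power primes_dvd_imp_eq two_is_prime_nat)
  have "?s\<^sup>2 = (\<Sum>i<k. (x ^ (2 ^ i))\<^sup>2)"
    by (rule freshmans_dream_sum) (simp_all add: char)
  also have "\<dots> = (\<Sum>i<k. x ^ (2 ^ Suc i))"
    by (simp only: power_mult[symmetric] power_Suc2)
  also have "\<dots> = ?s + x ^ (2 ^ k) - x"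
    using sum.lessThan_Suc_shift[of "\<lambda>i. x ^ (2 ^ i)" k]
    by (simp only: sum.lessThan_Suc power_0 power_one_right add_diff_cancel_left'
      add.commute[of _ x])
  also have "\<dots> = ?s"
    using finite_field_power_card_eq_same[of x] card by simp
  finally have "?s * ?s = ?s * 1"
    by (simp only: power2_eq_square mult_1_right)
  then have "?s = 0 \<or> ?s = 1"
    by (simp only: mult_cancel_left)
  then have "of_bit (if ?s = 0 then 0 else 1) = ?s"
    by auto
  then obtain b where b: "of_bit b = ?s" ..
  have "trace_to_F2 x = b"
    unfolding trace_to_F2_def deg
  proof (rule the_equality)
    fix c assume "of_bit c = ?s"
    with b have "(of_bit c :: 'a) = of_bit b" by simp
    then show "c = b" by (cases c; cases b) auto
  qed (fact b)
  with b show ?thesis by simp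
qed

definition primitive_element :: "'a::finite_field \<Rightarrow> bool" where
  "primitive_element \<alpha> \<longleftrightarrow> range (\<lambda>i::nat. \<alpha> ^ i) = UNIV - {0}"

definition codeword ::
    "nat \<Rightarrow> 'a::finite_field \<Rightarrow> 'b::finite_field \<Rightarrow> 'a \<Rightarrow> 'b \<Rightarrow> nat \<Rightarrow> bit" where
  "codeword n \<alpha>\<^sub>1 \<alpha>\<^sub>2 \<beta>\<^sub>1 \<beta>\<^sub>2 =
     (\<lambda>i. if i < n then trace_to_F2 (\<beta>\<^sub>1 * \<alpha>\<^sub>1 ^ i) + trace_to_F2 (\<beta>\<^sub>2 * \<alpha>\<^sub>2 ^ i) else 0)"

end

theory Submission
  imports Defs "HOL-Library.Product_Plus" "HOL-Computational_Algebra.Polynomial"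
    "HOL-Number_Theory.Pocklington"
begin

text \<open>
  Since \<open>2 ^ k\<^sub>1 - 1\<close> and \<open>2 ^ k\<^sub>2 - 1\<close> are coprime, the positions \<open>i < n\<close> correspond to the
  pairs \<open>(x, y)\<close> of nonzero field elements. A subspace \<open>D\<close> that meets the subcode trivially comes
  from the graph \<open>S\<close> of a linear map on a \<open>j\<close>-dimensional subspace of the first field, and \<open>D\<close>
  vanishes exactly at the pairs in the annihilator of \<open>S\<close> under the trace pairing that lie off both
  axes. By inclusion and exclusion their number depends only on \<open>j\<close> and the rank of the linear
  map, and it is largest when this rank is maximal, that is, \<open>min j k\<^sub>2\<close>.
\<close>

section \<open>Additive subgroups in characteristic 2\<close>

text \<open>Over GF(2) the subspaces are exactly the additive subgroups, so this one notion serves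
  sequences, fields and pairs of field elements without any scalar multiplication.\<close>

definition add_subgroup :: "'g::ab_group_add set \<Rightarrow> bool" where
  "add_subgroup S \<longleftrightarrow> 0 \<in> S \<and> (\<forall>x\<in>S. \<forall>y\<in>S. x - y \<in> S)"

lemma add_subgroup_zero: "add_subgroup S \<Longrightarrow> 0 \<in> S"
  and add_subgroup_diff: "add_subgroup S \<Longrightarrow> x \<in> S \<Longrightarrow> y \<in> S \<Longrightarrow> x - y \<in> S"
  by (auto simp: add_subgroup_def)

lemma add_subgroup_uminus: "add_subgroup S \<Longrightarrow> x \<in> S \<Longrightarrow> - x \<in> S"
  using add_subgroup_diff[of S 0 x] add_subgroup_zero[of S] by simp

lemma add_subgroup_add: "add_subgroup S \<Longrightarrow> x \<in> S \<Longrightarrow> y \<in> S \<Longrightarrow> x + y \<in> S"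
  using add_subgroup_diff[of S x "- y"] add_subgroup_uminus[of S y] by simp

lemma add_subgroup_image:
  assumes "add_subgroup S" and "additive f"
  shows "add_subgroup (f ` S)"
proof -
  interpret additive f by fact
  have "0 \<in> f ` S"
    using add_subgroup_zero[OF assms(1)] zero by (metis image_eqI)
  moreover have "f x - f y \<in> f ` S" if "x \<in> S" "y \<in> S" for x y
    using add_subgroup_diff[OF assms(1) that] diff by (metis image_eqI)
  ultimately show ?thesis
    by (auto simp: add_subgroup_def)
qed

text \<open>If \<open>a + a = 0\<close>, then 0 and \<open>a\<close> are the only multiples of
  \<open>a\<close>, so this is the subgroup generated by \<open>S\<close> and
  \<open>a\<close>.\<close>

definition adjoin :: "'g::ab_group_add \<Rightarrow> 'g set \<Rightarrow> 'g set" where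
  "adjoin a S = S \<union> (\<lambda>x. x + a) ` S"

lemma image_adjoin:
  assumes "additive f"
  shows "f ` adjoin a S = adjoin (f a) (f ` S)"
  using additive.add[OF assms] by (auto simp: adjoin_def image_Un image_image)

lemma adjoin_zero [simp]: "adjoin 0 S = S"
  by (simp add: adjoin_def)

lemma add_subgroup_adjoin:
  fixes a :: "'g::ab_group_add"
  assumes S: "add_subgroup S" and a: "a + a = 0"
  shows "add_subgroup (adjoin a S)"
proof -
  have "x - y \<in> adjoin a S" if x: "x \<in> adjoin a S" and y: "y \<in> adjoin a S" for x y
  proof -
    obtain s t where st: "s \<in> S" "t \<in> S"
      and xy: "x = s \<or> x = s + a" "y = t \<or> y = t + a"
      using x y by (auto simp: adjoin_def)
    have "s - (t + a) = (s - t) + a"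
      using a by (simp add: algebra_simps eq_neg_iff_add_eq_0)
    with xy have "x - y = s - t \<or> x - y = (s - t) + a"
      by (auto simp: algebra_simps)
    with add_subgroup_diff[OF S st] show ?thesis
      by (auto simp: adjoin_def)
  qed
  then show ?thesis
    using add_subgroup_zero[OF S] by (auto simp: add_subgroup_def adjoin_def)
qed

text \<open>The coset of \<open>a\<close> is disjoint from \<open>S\<close>, since a common element
  would make \<open>a\<close> a difference of two members of \<open>S\<close>.\<close>

lemma card_adjoin:
  fixes a :: "'g::ab_group_add"
  assumes S: "add_subgroup S" and "finite S" and a: "a \<notin> S"
  shows "card (adjoin a S) = 2 * card S"
proof -
  have "S \<inter> (\<lambda>x. x + a) ` S = {}"
  proof (rule ccontr)
    assume "\<not> ?thesis"
    then obtain x y where "x \<in> S" "y \<in> S" "x = y + a" by auto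
    then have "a = x - y" by simp
    with add_subgroup_diff[OF S \<open>x \<in> S\<close> \<open>y \<in> S\<close>] a show False by simp
  qed
  then show ?thesis
    using \<open>finite S\<close> by (simp add: adjoin_def card_Un_disjoint card_image)
qed

section \<open>Dimension and cardinality of binary subspaces\<close>

declare add_bit_eq_xor [simp del] mult_bit_eq_and [simp del]

lemma bit_self_add [simp]: "(b::bit) + b = 0"
  by (cases b) auto

lemma subspace_bit_iff:
  fixes D :: "(nat \<Rightarrow> bit) set"
  shows "seq_space.subspace D \<longleftrightarrow> add_subgroup D"
proof
  assume "seq_space.subspace D"
  then show "add_subgroup D"
    by (simp add: add_subgroup_def seq_space.subspace_0 seq_space.subspace_diff)
next
  assume D: "add_subgroup D"
  have "seq_scale c v \<in> D" if "v \<in> D" for c v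
  proof (cases c)
    case zero
    have "seq_scale 0 v = 0" by (simp add: seq_space.scale_zero_left)
    then show ?thesis using zero add_subgroup_zero[OF D] by simp
  next
    case one
    then show ?thesis using that seq_space.scale_one[of v] by simp
  qed
  then show "seq_space.subspace D"
    using add_subgroup_zero[OF D] add_subgroup_add[OF D]
    by (simp add: seq_space.subspace_def)
qed

lemma span_insert_bit:
  fixes B :: "(nat \<Rightarrow> bit) set"
  shows "seq_space.span (insert a B) = adjoin a (seq_space.span B)"
proof -
  have ex: "(\<exists>k. P k) \<longleftrightarrow> P 0 \<or> P 1" for P :: "bit \<Rightarrow> bool"
    by (metis bit.exhaust)
  have "x \<in> (\<lambda>x. x + a) ` seq_space.span B" if "x - a \<in> seq_space.span B" for x
    using that by (metis diff_add_cancel image_eqI)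
  then show ?thesis
    by (auto simp: seq_space.span_insert ex adjoin_def seq_space.scale_zero_left)
qed

lemma span_bit_card:
  fixes B :: "(nat \<Rightarrow> bit) set"
  assumes "finite B" and "seq_space.independent B"
  shows "finite (seq_space.span B) \<and> card (seq_space.span B) = 2 ^ card B"
  using assms
proof (induction B rule: finite_induct)
  case empty
  then show ?case by (simp add: seq_space.span_empty)
next
  case (insert a B)
  then have ind: "seq_space.independent B" "a \<notin> seq_space.span B"
    by (simp_all add: seq_space.independent_insert)
  have "add_subgroup (seq_space.span B)"
    by (simp add: subspace_bit_iff[symmetric] seq_space.subspace_span)
  with insert ind show ?case
    by (simp add: span_insert_bit card_adjoin) (simp add: adjoin_def)
qed

text \<open>This trades dimension for cardinality, so that all later arguments can count
  elements.\<close>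

lemma subspace_bit_card:
  fixes D :: "(nat \<Rightarrow> bit) set"
  assumes D: "seq_space.subspace D" and "finite D"
  shows "card D = 2 ^ seq_space.dim D"
proof -
  obtain B where B: "B \<subseteq> D" "seq_space.independent B" "D \<subseteq> seq_space.span B"
    "card B = seq_space.dim D"
    using seq_space.basis_exists by blast
  then have "seq_space.span B = D"
    using D seq_space.span_minimal by blast
  then show ?thesis
    using span_bit_card[of B] B \<open>finite D\<close> finite_subset by metis
qed

text \<open>With more than two elements there is a \<open>y\<close> avoiding both 0 and
  \<open>x\<close>. This later expresses points on the axes by points off them.\<close>

lemma ex_nonzero_split:
  fixes x :: "'g::{ab_group_add,finite}"
  assumes "CARD('g) > 2"
  obtains y z where "y \<noteq> 0" "z \<noteq> 0" "x = y + z"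
proof -
  have "card {0, x} \<le> 2" by (simp add: card_insert_if)
  then have "{0, x} \<noteq> UNIV" using assms by auto
  then obtain y where "y \<noteq> 0" "y \<noteq> x" by auto
  then show ?thesis using that[of y "x - y"] by simp
qed

section \<open>Annihilators under a pairing with values in GF(2)\<close>

text \<open>The nontrivial character of GF(2).\<close>

definition sign :: "bit \<Rightarrow> int" where
  "sign b = (if b = 0 then 1 else - 1)"

lemma sign_add: "sign (a + b) = sign a * sign b"
  by (cases a; cases b) (auto simp: sign_def)

text \<open>Orthogonality of characters: translation by some \<open>t\<close> with
  \<open>f t = 1\<close> permutes \<open>S\<close> and flips every sign, so the sum equals its own
  negative.\<close>

lemma sum_sign:
  fixes f :: "'g::ab_group_add \<Rightarrow> bit"
  assumes S: "add_subgroup S" and f: "additive f"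
  shows "(\<Sum>s\<in>S. sign (f s)) = (if \<forall>s\<in>S. f s = 0 then int (card S) else 0)"
proof (cases "\<forall>s\<in>S. f s = 0")
  case True
  then show ?thesis by (simp add: sign_def)
next
  case False
  then obtain t where t: "t \<in> S" "f t \<noteq> 0" by blast
  have "bij_betw (\<lambda>s. s + t) S S"
    by (rule bij_betw_byWitness[where f' = "\<lambda>s. s - t"])
      (use t S in \<open>auto intro: add_subgroup_add add_subgroup_diff\<close>)
  then have "(\<Sum>s\<in>S. sign (f s)) = (\<Sum>s\<in>S. sign (f (s + t)))"
    by (simp add: sum.reindex_bij_betw[where g = "\<lambda>s. sign (f s)"])
  also have "\<dots> = (\<Sum>s\<in>S. - sign (f s))"
    using t by (simp add: additive.add[OF f] sign_add sign_def[of 1])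
  also have "\<dots> = - (\<Sum>s\<in>S. sign (f s))"
    by (simp add: sum_negf)
  finally show ?thesis using False by auto
qed

definition annihilator :: "('g \<Rightarrow> 'h \<Rightarrow> bit) \<Rightarrow> 'g set \<Rightarrow> 'h set" where
  "annihilator p S = {x. \<forall>s\<in>S. p s x = 0}"

locale bit_pairing =
  fixes p :: "'g::{ab_group_add,finite} \<Rightarrow> 'h::{ab_group_add,finite} \<Rightarrow> bit"
  assumes add_left: "p (s + t) x = p s x + p t x"
    and add_right: "p s (x + y) = p s x + p s y"
    and nondegenerate: "(\<And>x. p s x = 0) \<Longrightarrow> s = 0"
begin

lemma additive_left: "additive (\<lambda>s. p s x)"
  by (simp add: additive_def add_left)

lemma additive_right: "additive (p s)"
  by (simp add: additive_def add_right)

lemma zero_left [simp]: "p 0 x = 0"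
  using additive.zero[OF additive_left] .

lemma zero_right [simp]: "p s 0 = 0"
  using additive.zero[OF additive_right] .

text \<open>Both sides count the sum of the signs of \<open>p s x\<close> over all \<open>s \<in> S\<close> and all \<open>x\<close>.\<close>

lemma card_annihilator:
  assumes S: "add_subgroup S"
  shows "card S * card (annihilator p S) = CARD('h)"
proof -
  have "(\<Sum>x\<in>UNIV. \<Sum>s\<in>S. sign (p s x)) =
      (\<Sum>x\<in>UNIV. if x \<in> annihilator p S then int (card S) else 0)"
    by (simp add: sum_sign[OF S additive_left] annihilator_def)
  also have "\<dots> = int (card S * card (annihilator p S))"
    by (simp add: sum.If_cases)
  finally have 1: "(\<Sum>x\<in>UNIV. \<Sum>s\<in>S. sign (p s x)) = int (card S * card (annihilator p S))" .
  have "(\<Sum>x\<in>UNIV. \<Sum>s\<in>S. sign (p s x)) = (\<Sum>s\<in>S. \<Sum>x\<in>UNIV. sign (p s x))"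
    by (rule sum.swap)
  \<comment> \<open>By nondegeneracy, the signs cancel over \<open>x\<close> for every nonzero
    \<open>s\<close>.\<close>
  also have "\<dots> = (\<Sum>s\<in>S. if s = 0 then int CARD('h) else 0)"
  proof (rule sum.cong)
    fix s
    have "add_subgroup (UNIV :: 'h set)" by (simp add: add_subgroup_def)
    moreover have "(\<forall>x. p s x = 0) \<longleftrightarrow> s = 0"
      using nondegenerate by auto
    ultimately show "(\<Sum>x\<in>UNIV. sign (p s x)) = (if s = 0 then int CARD('h) else 0)"
      by (simp add: sum_sign[OF _ additive_right])
  qed simp
  also have "\<dots> = int CARD('h)"
    using add_subgroup_zero[OF S] by simp
  finally show ?thesis using 1 by (simp only: of_nat_eq_iff)
qed

end

section \<open>The trace pairing\<close>

lemma two_le_card_field: "2 \<le> CARD('a::finite_field)"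
proof -
  have "card {0, 1::'a} \<le> CARD('a)" by (rule card_mono) simp_all
  then show ?thesis by simp
qed

text \<open>Translation by 1 permutes the field, so adding 1 to each element leaves the total
  unchanged. Hence \<open>CARD('a)\<close> is 0 in the field, and the prime \<open>CHAR('a)\<close>
  divides a power of 2.\<close>

lemma char_2_of_card:
  assumes "CARD('a::finite_field) = 2 ^ k"
  shows "CHAR('a) = 2"
proof -
  have "bij (\<lambda>y::'a. y + 1)"
    by (rule bij_betw_byWitness[where f' = "\<lambda>y. y - 1"]) auto
  then have "(\<Sum>y\<in>(UNIV::'a set). y + 1) = (\<Sum>y\<in>UNIV. y)"
    using sum.reindex_bij_betw[of "\<lambda>y::'a. y + 1" UNIV UNIV "\<lambda>y. y"] by simp
  then have "(of_nat CARD('a) :: 'a) = 0"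
    by (simp add: sum.distrib)
  then have "CHAR('a) dvd 2 ^ k"
    using assms of_nat_eq_0_iff_char_dvd by metis
  then show ?thesis
    by (metis CHAR_prime prime_dvd_power primes_dvd_imp_eq two_is_prime_nat)
qed

lemma self_add_of_card:
  assumes "CARD('a::finite_field) = 2 ^ k"
  shows "(x::'a) + x = 0"
proof -
  have "(of_nat 2 :: 'a) = 0"
    using char_2_of_card[OF assms] of_nat_CHAR[where ?'a = 'a] by metis
  then have "(2::'a) = 0" by simp
  then show ?thesis by (metis mult_2 mult_zero_left)
qed

text \<open>Each conjugate is additive by the Frobenius identity, and \<open>of_bit\<close> carries
  the sum back to GF(2) because \<open>1 + 1 = 0\<close> in the field.\<close>

lemma trace_to_F2_add:
  assumes card: "CARD('a::finite_field) = 2 ^ k"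
  shows "trace_to_F2 (x + y :: 'a) = trace_to_F2 x + trace_to_F2 y"
proof -
  note char = char_2_of_card[OF card]
  have power: "(x + y) ^ (2 ^ i) = x ^ (2 ^ i) + y ^ (2 ^ i)" for i
    by (rule freshmans_dream'[where n = i]) (simp_all add: char)
  have "(of_bit (trace_to_F2 (x + y)) :: 'a) =
      of_bit (trace_to_F2 x) + of_bit (trace_to_F2 y)"
    by (simp only: of_bit_trace_to_F2[OF card] sum.distrib power)
  then show ?thesis
    using self_add_of_card[OF card, of 1]
    by (cases "trace_to_F2 x"; cases "trace_to_F2 y"; cases "trace_to_F2 (x + y)") auto
qed

text \<open>As a polynomial, the trace has degree \<open>2 ^ (k - 1)\<close>, so it does not vanish on the
  whole field.\<close>

lemma trace_to_F2_nonzero: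
  assumes card: "CARD('a::finite_field) = 2 ^ k"
  shows "\<exists>x::'a. trace_to_F2 x \<noteq> 0"
proof (rule ccontr)
  assume "\<not> ?thesis"
  then have zero: "(\<Sum>i<k. x ^ (2 ^ i)) = 0" for x :: 'a
    using of_bit_trace_to_F2[OF card, of x] by simp
  define f :: "'a poly" where "f = (\<Sum>i<k. Polynomial.monom 1 (2 ^ i))"
  have "k \<noteq> 0"
    using card two_le_card_field[where 'a = 'a] by (intro notI) simp
  \<comment> \<open>The exponents \<open>2 ^ i\<close> are distinct, so only \<open>i = 0\<close>
    contributes to the linear coefficient, which is therefore 1.\<close>
  have "Polynomial.coeff f (2 ^ 0) = (\<Sum>i<k. if i = 0 then 1 else 0)"
    unfolding f_def coeff_sum by (rule sum.cong) (auto simp: coeff_monom)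
  then have "f \<noteq> 0"
    using \<open>k \<noteq> 0\<close> by auto
  have "degree f \<le> 2 ^ (k - 1)"
    unfolding f_def by (rule degree_sum_le) (auto intro!: degree_monom_le[THEN order_trans])
  moreover have "card {x. poly f x = 0} \<le> degree f"
    by (rule card_poly_roots_bound) fact
  moreover have "{x. poly f x = 0} = UNIV"
    using zero by (simp add: f_def poly_sum poly_monom)
  ultimately have "2 ^ k \<le> (2::nat) ^ (k - 1)"
    using card by (simp only: order_trans[of "2 ^ k" "degree f"])
  with \<open>k \<noteq> 0\<close> show False by simp
qed

text \<open>Multiplication by a nonzero \<open>\<beta>\<close> reaches every field element, in
  particular one of nonzero trace.\<close>

lemma trace_pairing:
  assumes card: "CARD('a::finite_field) = 2 ^ k"
  shows "bit_pairing (\<lambda>\<beta> x::'a. trace_to_F2 (\<beta> * x))"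
proof
  fix \<beta> :: 'a
  assume *: "trace_to_F2 (\<beta> * x) = 0" for x
  obtain y :: 'a where y: "trace_to_F2 y \<noteq> 0"
    using trace_to_F2_nonzero[OF card] by blast
  show "\<beta> = 0"
  proof (rule ccontr)
    assume "\<beta> \<noteq> 0"
    then have "\<beta> * (y / \<beta>) = y" by simp
    with *[of "y / \<beta>"] y show False by simp
  qed
qed (simp_all add: trace_to_F2_add[OF card] algebra_simps)

section \<open>The zero positions of a subcode\<close>

lemma product_pairing:
  assumes "bit_pairing p\<^sub>1" and "bit_pairing p\<^sub>2"
  shows "bit_pairing (\<lambda>s x. p\<^sub>1 (fst s) (fst x) + p\<^sub>2 (snd s) (snd x))"
proof -
  interpret p1: bit_pairing p\<^sub>1 by fact
  interpret p2: bit_pairing p\<^sub>2 by fact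
  show ?thesis
  proof
    fix s
    assume *: "p\<^sub>1 (fst s) (fst x) + p\<^sub>2 (snd s) (snd x) = 0" for x
    have "fst s = 0"
    proof (rule p1.nondegenerate)
      fix y show "p\<^sub>1 (fst s) y = 0" using *[of "(y, 0)"] by simp
    qed
    moreover have "snd s = 0"
    proof (rule p2.nondegenerate)
      fix y show "p\<^sub>2 (snd s) y = 0" using *[of "(0, y)"] by simp
    qed
    ultimately show "s = 0" by (simp add: prod_eq_iff)
  qed (simp_all add: p1.add_left p1.add_right p2.add_left p2.add_right algebra_simps)
qed

text \<open>On each axis the product pairing reduces to one factor, so the axis part of the
  annihilator is the annihilator of a projection of \<open>S\<close>. The two axis parts share only
  the origin, which accounts for the 1. The additive form avoids truncated subtraction.\<close>

lemma card_annihilator_off_axes: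
  fixes p\<^sub>1 :: "'a::{ab_group_add,finite} \<Rightarrow> 'c::{ab_group_add,finite} \<Rightarrow> bit"
    and p\<^sub>2 :: "'b::{ab_group_add,finite} \<Rightarrow> 'd::{ab_group_add,finite} \<Rightarrow> bit"
  assumes "bit_pairing p\<^sub>1" and "bit_pairing p\<^sub>2"
  defines "p \<equiv> \<lambda>s x. p\<^sub>1 (fst s) (fst x) + p\<^sub>2 (snd s) (snd x)"
  shows "card {x \<in> annihilator p S. fst x \<noteq> 0 \<and> snd x \<noteq> 0}
      + card (annihilator p\<^sub>1 (fst ` S)) + card (annihilator p\<^sub>2 (snd ` S))
      = card (annihilator p S) + 1"
proof -
  interpret p1: bit_pairing p\<^sub>1 by fact
  interpret p2: bit_pairing p\<^sub>2 by fact
  let ?N = "{x \<in> annihilator p S. fst x \<noteq> 0 \<and> snd x \<noteq> 0}"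
  let ?A = "annihilator p\<^sub>1 (fst ` S) \<times> {0::'d}" and ?B = "{0::'c} \<times> annihilator p\<^sub>2 (snd ` S)"
  have "annihilator p S = ?N \<union> (?A \<union> ?B)"
    by (auto simp: annihilator_def p_def)
  then have "card (annihilator p S) = card (?N \<union> (?A \<union> ?B))"
    by (rule arg_cong)
  also have "\<dots> = card ?N + card (?A \<union> ?B)"
    by (rule card_Un_disjoint) auto
  finally have "card (annihilator p S) = card ?N + card (?A \<union> ?B)" .
  moreover have "card ?A + card ?B = card (?A \<union> ?B) + card (?A \<inter> ?B)"
    by (rule card_Un_Int) simp_all
  moreover have "?A \<inter> ?B = {(0, 0)}"
    by (auto simp: annihilator_def)
  ultimately show ?thesis
    by (simp add: card_cartesian_product)
qed

text \<open>A graph of a linear map of maximal rank on a \<open>j\<close>-dimensional subspace, built up one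
  dimension at a time.\<close>

lemma ex_max_rank_graph:
  fixes k\<^sub>1 k\<^sub>2 :: nat
  assumes char: "\<And>x::'a::{ab_group_add,finite}. x + x = 0"
      "\<And>y::'b::{ab_group_add,finite}. y + y = 0"
    and card: "CARD('a) = 2 ^ k\<^sub>1" "CARD('b) = 2 ^ k\<^sub>2"
    and "j \<le> k\<^sub>1"
  shows "\<exists>S::('a \<times> 'b) set. add_subgroup S \<and> card S = 2 ^ j \<and> card (fst ` S) = 2 ^ j \<and>
      card (snd ` S) = 2 ^ min j k\<^sub>2"
  using \<open>j \<le> k\<^sub>1\<close>
proof (induction j)
  case 0
  show ?case
    by (rule exI[of _ "{0}"]) (simp add: add_subgroup_def)
next
  case (Suc j)
  then obtain S :: "('a \<times> 'b) set" where S: "add_subgroup S" "card S = 2 ^ j"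
    "card (fst ` S) = 2 ^ j" "card (snd ` S) = 2 ^ min j k\<^sub>2"
    by auto
  have fst: "additive (fst :: 'a \<times> 'b \<Rightarrow> 'a)" and snd: "additive (snd :: 'a \<times> 'b \<Rightarrow> 'b)"
    by (simp_all add: additive_def)
  have "fst ` S \<noteq> UNIV"
    using S card Suc.prems by (auto dest!: arg_cong[where f = card])
  \<comment> \<open>An \<open>a\<close> outside the first projection doubles that projection
    together with \<open>S\<close>, so \<open>S\<close> remains a graph.\<close>
  then obtain a where a: "a \<notin> fst ` S" by blast
  have "\<exists>b. card (adjoin b (snd ` S)) = 2 ^ min (Suc j) k\<^sub>2"
  proof (cases "j < k\<^sub>2")
    case True
    then have "snd ` S \<noteq> UNIV"
      using S card by (auto dest!: arg_cong[where f = card])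
    then obtain b where "b \<notin> snd ` S" by blast
    with True S show ?thesis
      by (intro exI[of _ b]) (simp add: card_adjoin add_subgroup_image[OF _ snd])
  next
    \<comment> \<open>The second projection is already the whole field, and \<open>b = 0\<close>
      leaves it unchanged.\<close>
    case False
    with S show ?thesis by (intro exI[of _ 0]) simp
  qed
  then obtain b where b: "card (adjoin b (snd ` S)) = 2 ^ min (Suc j) k\<^sub>2" ..
  have "(a, b) \<notin> S" using a by force
  then have "card (adjoin (a, b) S) = 2 ^ Suc j"
    using S by (simp add: card_adjoin)
  moreover have "add_subgroup (adjoin (a, b) S)"
    using S char by (simp add: add_subgroup_adjoin zero_prod_def)
  moreover have "card (fst ` adjoin (a, b) S) = 2 ^ Suc j"
    using a S by (simp add: image_adjoin[OF fst] card_adjoin add_subgroup_image[OF _ fst])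
  moreover have "card (snd ` adjoin (a, b) S) = 2 ^ min (Suc j) k\<^sub>2"
    using b by (simp add: image_adjoin[OF snd])
  ultimately show ?case by blast
qed

section \<open>Positions as pairs of nonzero field elements\<close>

text \<open>Modulo a common divisor, the order of 2 divides both \<open>m\<close> and
  \<open>n\<close>. It is therefore 1, and the divisor divides \<open>2 - 1\<close>.\<close>

lemma coprime_two_power_minus_1:
  assumes "coprime m n"
  shows "coprime (2 ^ m - 1 :: nat) (2 ^ n - 1)"
proof -
  let ?d = "gcd (2 ^ m - 1 :: nat) (2 ^ n - 1)"
  have "[2 ^ i = 1] (mod ?d)" if "?d dvd 2 ^ i - 1" for i
    using that by (subst cong_altdef_nat) simp_all
  then have "[2 ^ m = 1] (mod ?d)" "[2 ^ n = 1] (mod ?d)"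
    by simp_all
  then have "ord ?d 2 dvd m" "ord ?d 2 dvd n"
    by (simp_all only: ord_divides)
  then have "ord ?d 2 dvd 1"
    using assms by (metis coprime_def)
  then have "[2 ^ 1 = 1] (mod ?d)"
    by (simp only: ord_divides)
  then have "?d dvd 1"
    by (simp add: cong_altdef_nat)
  then show ?thesis
    by (simp add: coprime_iff_gcd_eq_1)
qed

lemma finite_field_power_card_minus_1:
  fixes x :: "'a::finite_field"
  assumes "x \<noteq> 0"
  shows "x ^ (CARD('a) - 1) = 1"
proof -
  have "CARD('a) = Suc (CARD('a) - 1)" by simp
  then have "x * x ^ (CARD('a) - 1) = x * 1"
    using finite_field_power_card_eq_same[of x] by (metis mult_1_right power_Suc)
  then show ?thesis using assms by simp
qed

lemma primitive_element_nonzero: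
  assumes "primitive_element \<alpha>"
  shows "\<alpha> \<noteq> 0"
  using assms rangeI[of "\<lambda>i. \<alpha> ^ i" 1] by (auto simp: primitive_element_def)

lemma power_cong_card_minus_1:
  fixes x :: "'a::finite_field"
  assumes "x \<noteq> 0" and "[i = j] (mod CARD('a) - 1)"
  shows "x ^ i = x ^ j"
proof -
  have "x ^ i = x ^ (i mod (CARD('a) - 1))" for i
  proof -
    have "x ^ i = x ^ ((CARD('a) - 1) * (i div (CARD('a) - 1)) + i mod (CARD('a) - 1))"
      by simp
    also have "\<dots> = x ^ (i mod (CARD('a) - 1))"
      using finite_field_power_card_minus_1[OF assms(1)]
      by (simp only: power_add power_mult power_one mult_1_left)
    finally show ?thesis .
  qed
  with assms(2) show ?thesis by (metis cong_def)
qed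

text \<open>The Chinese remainder theorem merges the two exponents into one position, which gives
  surjectivity. Injectivity follows because both sides have the same size.\<close>

lemma primitive_powers_bij:
  fixes \<alpha>\<^sub>1 :: "'a::finite_field" and \<alpha>\<^sub>2 :: "'b::finite_field"
  assumes "primitive_element \<alpha>\<^sub>1" and "primitive_element \<alpha>\<^sub>2"
    and coprime: "coprime (CARD('a) - 1) (CARD('b) - 1)"
  shows "bij_betw (\<lambda>i. (\<alpha>\<^sub>1 ^ i, \<alpha>\<^sub>2 ^ i)) {..<(CARD('a) - 1) * (CARD('b) - 1)}
    ((UNIV - {0}) \<times> (UNIV - {0}))" (is "bij_betw ?f ?I ?X")
proof -
  have nz: "\<alpha>\<^sub>1 \<noteq> 0" "\<alpha>\<^sub>2 \<noteq> 0"
    using assms primitive_element_nonzero by blast+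
  have pos: "CARD('a) - 1 \<noteq> 0" "CARD('b) - 1 \<noteq> 0"
    using two_le_card_field[where 'a = 'a] two_le_card_field[where 'a = 'b] by simp_all
  have "?X \<subseteq> ?f ` ?I"
  proof
    fix z assume "z \<in> ?X"
    then have "fst z \<in> range (\<lambda>i. \<alpha>\<^sub>1 ^ i)" "snd z \<in> range (\<lambda>i. \<alpha>\<^sub>2 ^ i)"
      using assms by (auto simp: primitive_element_def)
    then obtain a b where z: "z = (\<alpha>\<^sub>1 ^ a, \<alpha>\<^sub>2 ^ b)"
      by (cases z) auto
    obtain i where i: "i < (CARD('a) - 1) * (CARD('b) - 1)"
      "[i = a] (mod CARD('a) - 1)" "[i = b] (mod CARD('b) - 1)"
      using binary_chinese_remainder_unique_nat[OF coprime pos, of a b] by blast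
    have "z = ?f i"
      unfolding z using power_cong_card_minus_1[OF nz(1) i(2)] power_cong_card_minus_1[OF nz(2) i(3)]
      by simp
    with i show "z \<in> ?f ` ?I" by auto
  qed
  then have image: "?f ` ?I = ?X"
    using nz by auto
  have "card ?X = card ?I"
    by (simp add: card_cartesian_product card_Diff_singleton)
  with image have "inj_on ?f ?I"
    by (intro eq_card_imp_inj_on) simp_all
  with image show ?thesis by (simp add: bij_betw_def)
qed

section \<open>The codes\<close>

locale trace_code =
  fixes \<alpha>\<^sub>1 :: "'a::finite_field" and \<alpha>\<^sub>2 :: "'b::finite_field" and k\<^sub>1 k\<^sub>2 n :: nat
  assumes k_ge_2: "k\<^sub>1 \<ge> 2" "k\<^sub>2 \<ge> 2"
    and coprime_k: "coprime k\<^sub>1 k\<^sub>2"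
    and cards: "CARD('a) = 2 ^ k\<^sub>1" "CARD('b) = 2 ^ k\<^sub>2"
    and primitive: "primitive_element \<alpha>\<^sub>1" "primitive_element \<alpha>\<^sub>2"
    and n: "n = (2 ^ k\<^sub>1 - 1) * (2 ^ k\<^sub>2 - 1)"
begin

definition p\<^sub>1 :: "'a \<Rightarrow> 'a \<Rightarrow> bit" where "p\<^sub>1 \<beta> x = trace_to_F2 (\<beta> * x)"
definition p\<^sub>2 :: "'b \<Rightarrow> 'b \<Rightarrow> bit" where "p\<^sub>2 \<beta> y = trace_to_F2 (\<beta> * y)"
definition p :: "'a \<times> 'b \<Rightarrow> 'a \<times> 'b \<Rightarrow> bit" where
  "p = (\<lambda>s x. p\<^sub>1 (fst s) (fst x) + p\<^sub>2 (snd s) (snd x))"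

sublocale p1: bit_pairing p\<^sub>1
  using trace_pairing[OF cards(1)] by (simp add: p\<^sub>1_def[abs_def])

sublocale p2: bit_pairing p\<^sub>2
  using trace_pairing[OF cards(2)] by (simp add: p\<^sub>2_def[abs_def])

sublocale p: bit_pairing p
  unfolding p_def by (rule product_pairing) unfold_locales

definition point :: "nat \<Rightarrow> 'a \<times> 'b" where "point i = (\<alpha>\<^sub>1 ^ i, \<alpha>\<^sub>2 ^ i)"

lemma point_bij: "bij_betw point {..<n} ((UNIV - {0}) \<times> (UNIV - {0}))"
  using primitive_powers_bij[OF primitive] coprime_two_power_minus_1[OF coprime_k]
  by (simp add: cards n point_def[abs_def])

definition encode :: "'a \<times> 'b \<Rightarrow> nat \<Rightarrow> bit" where
  "encode s = codeword n \<alpha>\<^sub>1 \<alpha>\<^sub>2 (fst s) (snd s)"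

text \<open>Reading a codeword as a row of pairing values turns its zeros into annihilator
  points.\<close>

lemma encode_apply: "encode s i = (if i < n then p s (point i) else 0)"
  by (simp add: encode_def codeword_def p_def p\<^sub>1_def p\<^sub>2_def point_def)

lemma encode_additive: "additive encode"
  unfolding additive_def by (intro allI ext) (simp add: encode_apply p.add_left)

text \<open>A zero codeword says directly only that \<open>p s\<close> vanishes off the axes. Since
  \<open>k_ge_2\<close> gives both fields more than two elements, every pair is a sum of pairs off
  the axes, and nondegeneracy applies.\<close>

lemma encode_eq_0:
  assumes "encode s = 0"
  shows "s = 0"
proof (rule p.nondegenerate)
  have off_axes: "p s (x, y) = 0" if "x \<noteq> 0" "y \<noteq> 0" for x y
  proof -
    have "(x, y) \<in> point ` {..<n}"
      using point_bij that by (simp add: bij_betw_def)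
    then obtain i where "i < n" "(x, y) = point i" by auto
    with fun_cong[OF assms, of i] show ?thesis by (simp add: encode_apply)
  qed
  have gt2: "CARD('a) > 2" "CARD('b) > 2"
    using k_ge_2 power_strict_increasing[of 1 k\<^sub>1 "2::nat"] power_strict_increasing[of 1 k\<^sub>2 "2::nat"]
    by (simp_all add: cards)
  have right: "p s (x, y) = 0" if "x \<noteq> 0" for x y
  proof -
    obtain y\<^sub>1 y\<^sub>2 where y: "y\<^sub>1 \<noteq> 0" "y\<^sub>2 \<noteq> 0" "y = y\<^sub>1 + y\<^sub>2"
      using ex_nonzero_split[OF gt2(2)] by metis
    obtain x\<^sub>1 x\<^sub>2 where x: "x\<^sub>1 \<noteq> 0" "x\<^sub>2 \<noteq> 0" "x = x\<^sub>1 + x\<^sub>2"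
      using ex_nonzero_split[OF gt2(1)] by metis
    have "p s (x, y) = p s (x\<^sub>1, y\<^sub>1) + p s (x\<^sub>2, y\<^sub>2)"
      using x y p.add_right[of s "(x\<^sub>1, y\<^sub>1)" "(x\<^sub>2, y\<^sub>2)"] by simp
    then show ?thesis using off_axes x y by simp
  qed
  fix z :: "'a \<times> 'b"
  obtain x\<^sub>1 x\<^sub>2 where x: "x\<^sub>1 \<noteq> 0" "x\<^sub>2 \<noteq> 0" "fst z = x\<^sub>1 + x\<^sub>2"
    using ex_nonzero_split[OF gt2(1)] by metis
  \<comment> \<open>Both summands have a nonzero first component, so \<open>right\<close> covers
    them, whatever the second component is.\<close>
  then have "p s z = p s (x\<^sub>1, snd z) + p s (x\<^sub>2, 0)"
    using p.add_right[of s "(x\<^sub>1, snd z)" "(x\<^sub>2, 0)"] by (metis add_Pair add_0_right prod.collapse)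
  then show "p s z = 0" using right x by simp
qed

lemma encode_inj: "inj encode"
proof (rule injI)
  fix s t assume "encode s = encode t"
  then have "encode (s - t) = 0"
    by (simp add: additive.diff[OF encode_additive])
  then show "s = t" using encode_eq_0 by fastforce
qed

lemma card_Supp_encode:
  "card (Supp (encode ` S)) + card {x \<in> annihilator p S. fst x \<noteq> 0 \<and> snd x \<noteq> 0} = n"
proof -
  let ?Z = "{x \<in> annihilator p S. fst x \<noteq> 0 \<and> snd x \<noteq> 0}"
  have inj: "inj_on point {..<n}" and image: "point ` {..<n} = (UNIV - {0}) \<times> (UNIV - {0})"
    using point_bij by (simp_all add: bij_betw_def)
  have "point ` {i \<in> {..<n}. point i \<in> annihilator p S} = point ` {..<n} \<inter> annihilator p S"
    by auto
  also have "\<dots> = ?Z"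
    unfolding image by auto
  finally have "card ?Z = card {i \<in> {..<n}. point i \<in> annihilator p S}"
    using card_image[OF inj_on_subset[OF inj], of "{i \<in> {..<n}. point i \<in> annihilator p S}"] by auto
  moreover have "Supp (encode ` S) = {i \<in> {..<n}. point i \<notin> annihilator p S}"
    by (auto simp: Supp_def encode_apply annihilator_def)
  moreover have "card {i \<in> {..<n}. point i \<notin> annihilator p S} +
      card {i \<in> {..<n}. point i \<in> annihilator p S} = card {..<n}"
    by (subst card_Un_disjoint[symmetric]) (force intro!: arg_cong[where f = card])+
  ultimately show ?thesis by simp
qed

text \<open>Since \<open>S\<close> and its first projection have size \<open>2 ^ j\<close>, two of
  the three annihilators have sizes fixed by \<open>j\<close>. Only the one of the second projection
  still depends on \<open>S\<close>.\<close>

lemma card_Supp_graph: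
  assumes S: "add_subgroup S" and "card S = 2 ^ j" and "card (fst ` S) = 2 ^ j" and "j \<le> k\<^sub>1"
  shows "card (Supp (encode ` S)) + 2 ^ (k\<^sub>1 + k\<^sub>2 - j) + 1 =
    n + 2 ^ (k\<^sub>1 - j) + card (annihilator p\<^sub>2 (snd ` S))"
proof -
  have "additive (fst :: 'a \<times> 'b \<Rightarrow> 'a)" by (simp add: additive_def)
  then have "2 ^ j * card (annihilator p\<^sub>1 (fst ` S)) = 2 ^ k\<^sub>1"
    using p1.card_annihilator add_subgroup_image[OF S] assms cards by metis
  moreover have "2 ^ k\<^sub>1 = 2 ^ j * (2::nat) ^ (k\<^sub>1 - j)"
    using \<open>j \<le> k\<^sub>1\<close> by (simp flip: power_add)
  ultimately have 1: "card (annihilator p\<^sub>1 (fst ` S)) = 2 ^ (k\<^sub>1 - j)"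
    by simp
  have "2 ^ j * card (annihilator p S) = 2 ^ (k\<^sub>1 + k\<^sub>2)"
    using p.card_annihilator[OF S] assms cards by (simp add: power_add)
  moreover have "2 ^ (k\<^sub>1 + k\<^sub>2) = 2 ^ j * (2::nat) ^ (k\<^sub>1 + k\<^sub>2 - j)"
    using \<open>j \<le> k\<^sub>1\<close> by (simp flip: power_add)
  ultimately have 2: "card (annihilator p S) = 2 ^ (k\<^sub>1 + k\<^sub>2 - j)"
    by simp
  show ?thesis
    using card_Supp_encode[of S] 1 2
      card_annihilator_off_axes[OF p1.bit_pairing_axioms p2.bit_pairing_axioms, of S]
    by (simp add: p_def)
qed

text \<open>The product is \<open>2 ^ k\<^sub>2\<close>, factored so that the maximal rank
  \<open>min j k\<^sub>2\<close> can be cancelled. For \<open>j > k\<^sub>2\<close> the truncated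
  difference makes the second factor 1.\<close>

lemma card_annihilator_snd:
  fixes S :: "('a \<times> 'b) set"
  assumes S: "add_subgroup S"
  shows "card (snd ` S) * card (annihilator p\<^sub>2 (snd ` S)) = 2 ^ min j k\<^sub>2 * 2 ^ (k\<^sub>2 - j)"
proof -
  have "additive (snd :: 'a \<times> 'b \<Rightarrow> 'b)" by (simp add: additive_def)
  then have "card (snd ` S) * card (annihilator p\<^sub>2 (snd ` S)) = 2 ^ k\<^sub>2"
    using p2.card_annihilator[OF add_subgroup_image[OF S]] cards(2) by metis
  also have "\<dots> = 2 ^ (min j k\<^sub>2 + (k\<^sub>2 - j))"
    by (rule arg_cong[where f = "power 2"]) simp
  finally show ?thesis by (simp only: power_add)
qed

lemma code_eq: "{codeword n \<alpha>\<^sub>1 \<alpha>\<^sub>2 \<beta>\<^sub>1 \<beta>\<^sub>2 | \<beta>\<^sub>1 \<beta>\<^sub>2. True} = range encode"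
  by (auto simp: encode_def image_iff) metis

lemma subcode_eq: "{codeword n \<alpha>\<^sub>1 \<alpha>\<^sub>2 0 \<beta>\<^sub>2 | \<beta>\<^sub>2. True} = encode ` ({0} \<times> UNIV)"
  by (auto simp: encode_def image_iff)

lemma admissible_iff:
  "D \<subseteq> range encode \<and> seq_space.subspace D \<and> seq_space.dim D = j \<and>
      D \<inter> encode ` ({0} \<times> UNIV) = {0} \<longleftrightarrow>
    (\<exists>S. D = encode ` S \<and> add_subgroup S \<and> card S = 2 ^ j \<and> card (fst ` S) = 2 ^ j)"
  (is "?L \<longleftrightarrow> ?R")
proof
  assume ?L
  define S where "S = encode -` D"
  have D: "D = encode ` S" using \<open>?L\<close> by (auto simp: S_def)
  have sub: "add_subgroup D" using \<open>?L\<close> by (simp add: subspace_bit_iff)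
  have S: "add_subgroup S"
    unfolding add_subgroup_def S_def
    using add_subgroup_zero[OF sub] add_subgroup_diff[OF sub]
    by (auto simp: additive.zero[OF encode_additive] additive.diff[OF encode_additive])
  have "card D = card S"
    unfolding D by (rule card_image) (rule inj_on_subset[OF encode_inj subset_UNIV])
  moreover have "card D = 2 ^ j"
    using subspace_bit_card[of D] \<open>?L\<close> D by simp
  moreover have "inj_on fst S"
  proof (rule inj_onI)
    \<comment> \<open>The difference has first component 0, so its codeword lies in both
      \<open>D\<close> and the subcode.\<close>
    fix s t assume st: "s \<in> S" "t \<in> S" "fst s = fst t"
    then have "s - t \<in> {0} \<times> UNIV" by (simp add: mem_Times_iff)
    moreover have "encode (s - t) \<in> D"
      unfolding D by (rule imageI) (rule add_subgroup_diff[OF S st(1,2)])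
    ultimately have "encode (s - t) \<in> D \<inter> encode ` ({0} \<times> UNIV)"
      by (intro IntI imageI)
    moreover have "D \<inter> encode ` ({0} \<times> UNIV) = {0}" using \<open>?L\<close> by (elim conjE)
    ultimately have "encode (s - t) = 0" by (metis singletonD)
    then show "s = t" using encode_eq_0 by fastforce
  qed
  ultimately show ?R
    using D S card_image[of fst S] by (intro exI[of _ S] conjI) simp_all
next
  assume ?R
  then obtain S where D: "D = encode ` S" and S: "add_subgroup S" "card S = 2 ^ j"
    "card (fst ` S) = 2 ^ j" by blast
  have "card D = card S"
    unfolding D by (rule card_image) (rule inj_on_subset[OF encode_inj subset_UNIV])
  have sub: "add_subgroup D"
    unfolding D by (rule add_subgroup_image[OF S(1) encode_additive])
  then have "2 ^ seq_space.dim D = (2::nat) ^ j"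
    using subspace_bit_card[of D] D S(2) \<open>card D = card S\<close> by (simp add: subspace_bit_iff)
  moreover have "D \<inter> encode ` ({0} \<times> UNIV) \<subseteq> {0}"
  proof
    fix v assume "v \<in> D \<inter> encode ` ({0} \<times> UNIV)"
    then obtain s where s: "v = encode s" "s \<in> S" "fst s = 0"
      using injD[OF encode_inj] unfolding D by fastforce
    have "inj_on fst S"
      using S by (intro eq_card_imp_inj_on) simp_all
    then have "s = 0"
      using s add_subgroup_zero[OF S(1)] by (metis fst_zero inj_onD)
    then show "v \<in> {0}"
      using s additive.zero[OF encode_additive] by simp
  qed
  moreover have "0 \<in> encode ` ({0} \<times> UNIV)"
    using imageI[of 0 "{0} \<times> UNIV" encode]
    by (simp only: additive.zero[OF encode_additive]) (simp add: zero_prod_def)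
  ultimately show ?L
    using sub add_subgroup_zero[OF sub] D by (auto simp: subspace_bit_iff)
qed

lemma rel_gen_Hamming_weight_eq:
  assumes "j \<le> k\<^sub>1"
  shows "rel_gen_Hamming_weight j (range encode) (encode ` ({0} \<times> UNIV)) + 2 ^ (k\<^sub>1 + k\<^sub>2 - j) + 1
    = n + 2 ^ (k\<^sub>1 - j) + 2 ^ (k\<^sub>2 - j)"
proof -
  let ?G = "{S :: ('a \<times> 'b) set. add_subgroup S \<and> card S = 2 ^ j \<and> card (fst ` S) = 2 ^ j}"
  let ?w = "\<lambda>S. card (Supp (encode ` S))"
  obtain S\<^sub>0 :: "('a \<times> 'b) set" where S0: "add_subgroup S\<^sub>0" "card S\<^sub>0 = 2 ^ j"
    "card (fst ` S\<^sub>0) = 2 ^ j" "card (snd ` S\<^sub>0) = 2 ^ min j k\<^sub>2"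
    using ex_max_rank_graph[OF self_add_of_card[OF cards(1)] self_add_of_card[OF cards(2)]
        cards assms] by blast
  then have ann0: "card (annihilator p\<^sub>2 (snd ` S\<^sub>0)) = 2 ^ (k\<^sub>2 - j)"
    using card_annihilator_snd[of S\<^sub>0 j] by simp
  \<comment> \<open>The second projection is bounded by the size of \<open>S\<close> and by that of
    the field, so its annihilator is smallest at maximal rank.\<close>
  have ann: "2 ^ (k\<^sub>2 - j) \<le> card (annihilator p\<^sub>2 (snd ` S))" if S: "S \<in> ?G" for S
  proof -
    have "card (snd ` S) \<le> 2 ^ j"
      using S card_image_le[OF finite[of S], of snd] by simp
    moreover have "card (snd ` S) \<le> 2 ^ k\<^sub>2"
      using card_mono[of UNIV "snd ` S"] cards by simp
    ultimately have "card (snd ` S) \<le> 2 ^ min j k\<^sub>2"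
      by (simp add: min_def)
    then have "2 ^ min j k\<^sub>2 * 2 ^ (k\<^sub>2 - j) \<le> 2 ^ min j k\<^sub>2 * card (annihilator p\<^sub>2 (snd ` S))"
      using card_annihilator_snd[of S j] S by (metis (no_types, lifting) mem_Collect_eq mult_le_mono1)
    then show ?thesis by simp
  qed
  have "rel_gen_Hamming_weight j (range encode) (encode ` ({0} \<times> UNIV)) = Min (?w ` ?G)"
    unfolding rel_gen_Hamming_weight_def admissible_iff
    by (rule arg_cong[where f = Min]) blast
  also have "\<dots> = ?w S\<^sub>0"
  \<comment> \<open>By \<open>card_Supp_graph\<close> the support size is a constant plus the size
    of this annihilator, so \<open>S\<^sub>0\<close> attains the minimum.\<close>
  proof (rule Min_eqI)
    fix m assume "m \<in> ?w ` ?G"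
    then obtain S where "m = ?w S" "S \<in> ?G" by blast
    then show "?w S\<^sub>0 \<le> m"
      using card_Supp_graph[OF _ _ _ assms, of S] card_Supp_graph[OF S0(1-3) assms] ann0 ann[of S]
      by simp
  qed (use S0 in auto)
  finally show ?thesis
    using card_Supp_graph[OF S0(1-3) assms] ann0 by simp
qed

end

theorem corollary2p1:
  fixes \<alpha>\<^sub>1 :: "'a::finite_field" and \<alpha>\<^sub>2 :: "'b::finite_field"
    and k\<^sub>1 k\<^sub>2 Q\<^sub>1 Q\<^sub>2 n :: nat and C C' :: "(nat \<Rightarrow> bit) set" and N :: "nat \<Rightarrow> int"
  assumes "k\<^sub>1 \<ge> 2" and "k\<^sub>2 \<ge> 2" and "gcd k\<^sub>1 k\<^sub>2 = 1"
    and "Q\<^sub>1 = 2 ^ k\<^sub>1" and "Q\<^sub>2 = 2 ^ k\<^sub>2"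
    and "CARD('a) = Q\<^sub>1" and "CARD('b) = Q\<^sub>2"
    and "primitive_element \<alpha>\<^sub>1" and "primitive_element \<alpha>\<^sub>2"
    and "n = (Q\<^sub>1 - 1) * (Q\<^sub>2 - 1)"
    and "C = {codeword n \<alpha>\<^sub>1 \<alpha>\<^sub>2 \<beta>\<^sub>1 \<beta>\<^sub>2 | \<beta>\<^sub>1 \<beta>\<^sub>2. True}"
    and "C' = {codeword n \<alpha>\<^sub>1 \<alpha>\<^sub>2 0 \<beta>\<^sub>2 | \<beta>\<^sub>2. True}"
    and "\<And>j. N j =
           (if k\<^sub>1 \<le> k\<^sub>2
            then 2 ^ (k\<^sub>1 + k\<^sub>2 - j) - 2 ^ (k\<^sub>1 - j) - 2 ^ (k\<^sub>2 - j) + 1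
            else if j \<le> k\<^sub>2
            then 2 ^ (k\<^sub>1 + k\<^sub>2 - j) - 2 ^ (k\<^sub>1 - j) - 2 ^ (k\<^sub>2 - j) + 1
            else 2 ^ (k\<^sub>1 + k\<^sub>2 - j) - 2 ^ (k\<^sub>1 - j))"
  shows "\<forall>j. 1 \<le> j \<and> j \<le> k\<^sub>1 \<longrightarrow>
           int (rel_gen_Hamming_weight j C C') = (int Q\<^sub>1 - 1) * (int Q\<^sub>2 - 1) - N j"
proof (intro allI impI)
  fix j assume j: "1 \<le> j \<and> j \<le> k\<^sub>1"
  interpret trace_code \<alpha>\<^sub>1 \<alpha>\<^sub>2 k\<^sub>1 k\<^sub>2 n
    by unfold_locales (use assms in \<open>simp_all add: coprime_iff_gcd_eq_1\<close>)
  have "rel_gen_Hamming_weight j C C' + 2 ^ (k\<^sub>1 + k\<^sub>2 - j) + 1 = n + 2 ^ (k\<^sub>1 - j) + 2 ^ (k\<^sub>2 - j)"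
    unfolding assms(11,12) code_eq subcode_eq using rel_gen_Hamming_weight_eq[of j] j by simp
  then have "int (rel_gen_Hamming_weight j C C' + 2 ^ (k\<^sub>1 + k\<^sub>2 - j) + 1) =
      int (n + 2 ^ (k\<^sub>1 - j) + 2 ^ (k\<^sub>2 - j))"
    by simp
  moreover have "int n = (int Q\<^sub>1 - 1) * (int Q\<^sub>2 - 1)"
    using assms(4,5,10) by (simp add: of_nat_diff)
  \<comment> \<open>All cases agree: for \<open>j > k\<^sub>2\<close> the truncated exponent gives
    \<open>2 ^ (k\<^sub>2 - j) = 1\<close>, which cancels the final 1, and
    \<open>k\<^sub>1 \<le> k\<^sub>2\<close> excludes such \<open>j\<close>.\<close>
  moreover have "N j = 2 ^ (k\<^sub>1 + k\<^sub>2 - j) - 2 ^ (k\<^sub>1 - j) - 2 ^ (k\<^sub>2 - j) + 1"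
    using assms(13)[of j] j by auto
  ultimately show "int (rel_gen_Hamming_weight j C C') = (int Q\<^sub>1 - 1) * (int Q\<^sub>2 - 1) - N j"
    by simp
qed

end
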